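(* For each $k\ge1$ and each $w\in\mathcal{C}_{2k}$, the word limits $p_\theta(w)$, $\theta\in(1,\infty)$, satisfy $p_\theta(w)\sim\theta^{k-1}$ as $\theta\to\infty$, i.e. $p_\theta(w)/\theta^{k-1}\to1$ as $\theta\to\infty$.
   Context: For $\theta\in(0,\infty)$ and $n$ large enough that $\lfloor n/\theta\rfloor\ge1$, let $L_\theta(i,j)=(i+j)\bmod\lfloor n/\theta\rfloor$ for $1\le i,j\le n$. A word of length $2k$ is a sequence of $2k$ letters whose first occurrences are in alphabetical order; $w[i]$ is its $i$-th letter; it is pair-matched if every letter appears exactly twice. A pair-matched word is Catalan if sequentially deleting all double letters (two adjacent equal letters) reduces the word to the empty word (e.g. $aabb$, $abbcca$); $\mathcal{C}_{2k}$ is the set of Catalan words of length $2k$. A circuit of length $2k$ is a function $\pi:\{0,\dots,2k\}\to\{1,\dots,n\}$ with $\pi(0)=\pi(2k)$. For a pair-matched word $w$ of length $2k$, $\Pi_\theta^*(w)$ is the set of such circuits for which $w[i]=w[j]$ implies $L_\theta(\pi(i-1),\pi(i))=L_\theta(\pi(j-1),\pi(j))$, and $p_\theta(w)=\lim_{n\to\infty}n^{-(k+1)}\#\Pi_\theta^*(w)$ (this limit exists). *)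

theory Defs
  imports Complex_Main "HOL-Library.FuncSet"
begin

text \<open>Letters are natural numbers, with 0, 1, 2, ... standing for a, b, c, ...; the
  \<open>i\<close>-th letter of a word \<open>w\<close>, counted from 1, is \<open>w ! (i - 1)\<close>.\<close>

text \<open>First occurrences in alphabetical order: a letter can only occur after all letters
  preceding it in the alphabet have occurred.\<close>

definition is_word :: "nat list \<Rightarrow> bool" where
  "is_word w \<longleftrightarrow> (\<forall>i<length w. \<forall>b<w ! i. \<exists>j<i. w ! j = b)"

definition pair_matched :: "nat list \<Rightarrow> bool" where
  "pair_matched w \<longleftrightarrow> is_word w \<and> (\<forall>a\<in>set w. count_list w a = 2)"

inductive delete_double :: "nat list \<Rightarrow> nat list \<Rightarrow> bool" where
  "delete_double (u @ [a, a] @ v) (u @ v)"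

definition catalan_words :: "nat \<Rightarrow> nat list set" where
  "catalan_words k =
     {w. length w = 2 * k \<and> pair_matched w \<and> delete_double\<^sup>*\<^sup>* w []}"

definition link :: "real \<Rightarrow> nat \<Rightarrow> nat \<Rightarrow> nat \<Rightarrow> nat" where
  "link \<theta> n i j = (i + j) mod nat \<lfloor>real n / \<theta>\<rfloor>"

text \<open>Circuits are extensional functions, so that finitely many values determine a circuit.\<close>

definition circuits :: "nat \<Rightarrow> nat \<Rightarrow> (nat \<Rightarrow> nat) set" where
  "circuits l n = {\<pi> \<in> {0..l} \<rightarrow>\<^sub>E {1..n}. \<pi> 0 = \<pi> l}"

definition matched_circuits :: "real \<Rightarrow> nat \<Rightarrow> nat list \<Rightarrow> (nat \<Rightarrow> nat) set" where
  "matched_circuits \<theta> n w =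
     {\<pi> \<in> circuits (length w) n.
        \<forall>i\<in>{1..length w}. \<forall>j\<in>{1..length w}. w ! (i - 1) = w ! (j - 1) \<longrightarrow>
          link \<theta> n (\<pi> (i - 1)) (\<pi> i) = link \<theta> n (\<pi> (j - 1)) (\<pi> j)}"

text \<open>The limit is only meant for words of even length. The finitely many \<open>n < \<theta>\<close>, for which
  the modulus in \<^const>\<open>link\<close> is 0, do not affect it.\<close>

definition word_limit :: "real \<Rightarrow> nat list \<Rightarrow> real" where
  "word_limit \<theta> w =
     lim (\<lambda>n. real (card (matched_circuits \<theta> n w)) / real n ^ (length w div 2 + 1))"

end

theory Submission
  imports Defs
begin

text \<open>
  Let \<open>m = \<lfloor>n / \<theta>\<rfloor>\<close>. Whether a circuit is matched only depends on its values modulo \<open>m\<close>, so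
  circuits are counted by residue sequences \<open>r\<^sub>0, \<dots>, r\<^sub>2\<^sub>k\<close> weighted by \<open>\<Prod>\<^sub>i c(r\<^sub>i)\<close>, where
  \<open>c(r)\<close> is the number of \<open>x \<in> {1..n}\<close> with residue \<open>r\<close>. A double letter forces the residues on
  both sides of it to agree and leaves the one in the middle free. Deleting it therefore splits off
  a factor \<open>\<Sum>\<^sub>r c(r)\<^sup>d\<close> and merges two vertices, adding up their exponents. A Catalan word thus gives
  a product of \<open>k + 1\<close> such power sums with exponents adding up to \<open>2 k\<close>. As \<open>c(r)\<close> is one of
  \<open>\<lfloor>n / m\<rfloor>\<close>, \<open>\<lfloor>n / m\<rfloor> + 1\<close> and \<open>\<Sum>\<^sub>r c(r) = n\<close>, each power sum divided by \<open>n\<close> converges, and its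
  limit is asymptotic to \<open>\<theta> ^ (d - 1)\<close>; the exponents add up to \<open>2 k - (k + 1) = k - 1\<close>.
\<close>

section \<open>Residue walks and the deletion of double letters\<close>

fun edge_sums :: "nat \<Rightarrow> nat list \<Rightarrow> nat list" where
  "edge_sums m (x # y # zs) = (x + y) mod m # edge_sums m (y # zs)"
| "edge_sums m _ = []"

lemma length_edge_sums [simp]: "length (edge_sums m rs) = length rs - 1"
  by (induction m rs rule: edge_sums.induct) auto

lemma nth_edge_sums:
  "Suc i < length rs \<Longrightarrow> edge_sums m rs ! i = (rs ! i + rs ! Suc i) mod m"
proof (induction m rs arbitrary: i rule: edge_sums.induct)
  case (1 m x y zs)
  then show ?case by (cases i) auto
qed auto

lemma edge_sums_append:
  "edge_sums m (xs @ x # zs) = edge_sums m (xs @ [x]) @ edge_sums m (x # zs)"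
proof (induction xs)
  case (Cons a xs)
  then show ?case by (cases xs) auto
qed auto

text \<open>A witness \<open>\<phi>\<close> sends each letter to the common sum of its edges; its
  existence encodes the matching condition. Equality of the two ends is not imposed: for the words
  considered it is a consequence, see \<open>residue_walks_closed\<close>.\<close>

definition residue_walks :: "nat \<Rightarrow> nat list \<Rightarrow> nat list set" where
  "residue_walks m w = {rs. set rs \<subseteq> {..<m} \<and> length rs = Suc (length w) \<and>
     (\<exists>\<phi>. edge_sums m rs = map \<phi> w)}"

lemma finite_residue_walks: "finite (residue_walks m w)"
  by (rule finite_subset[OF _ finite_lists_length_eq[of "{..<m}" "Suc (length w)"]])
    (auto simp: residue_walks_def)

lemma eq_if_add_mod_eq:
  fixes x x' y m :: nat
  assumes "(x + y) mod m = (y + x') mod m" "x < m" "x' < m"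
  shows "x = x'"
proof -
  \<comment> \<open>Cancelling \<open>y\<close> is done in the integers, where subtraction is not
    truncated.\<close>
  have "int ((x + y) mod m) = int ((y + x') mod m)" using assms by simp
  then have "(int x + int y) mod int m = (int x' + int y) mod int m"
    by (simp add: zmod_int add.commute)
  then have "(int x + int y - int y) mod int m = (int x' + int y - int y) mod int m"
    by (rule mod_diff_cong) simp
  then show ?thesis using assms by simp
qed

text \<open>The two edges labelled \<open>a\<close> have sums \<open>x + y\<close> and
  \<open>y + x'\<close>; cancelling \<open>y\<close> modulo \<open>m\<close> forces
  \<open>x' = x\<close> and leaves \<open>y\<close> free. Conversely, \<open>a\<close> labels no
  other edge, so \<open>\<phi>\<close> can be redefined at \<open>a\<close> without disturbing the
  rest.\<close>

lemma residue_walks_insert_double: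
  assumes len: "length xs = length u" and lz: "length zs = length v"
    and a: "a \<notin> set u" "a \<notin> set v"
  shows "xs @ [x, y, x'] @ zs \<in> residue_walks m (u @ [a, a] @ v) \<longleftrightarrow>
    y < m \<and> x' = x \<and> xs @ x # zs \<in> residue_walks m (u @ v)" (is "?L \<longleftrightarrow> ?R")
proof -
  have e: "edge_sums m (xs @ [x, y, x'] @ zs) =
      edge_sums m (xs @ [x]) @ [(x + y) mod m, (y + x') mod m] @ edge_sums m (x' # zs)"
    using edge_sums_append[of m xs x "y # x' # zs"] by simp
  have e': "edge_sums m (xs @ x # zs) = edge_sums m (xs @ [x]) @ edge_sums m (x # zs)"
    by (rule edge_sums_append)
  have l1: "length (edge_sums m (xs @ [x])) = length u"
    using len by simp
  show ?thesis
  proof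
    assume L: ?L
    then obtain \<phi> where "edge_sums m (xs @ [x, y, x'] @ zs) = map \<phi> (u @ [a, a] @ v)"
      unfolding residue_walks_def by blast
    with l1 have p: "edge_sums m (xs @ [x]) = map \<phi> u"
      "(x + y) mod m = \<phi> a" "(y + x') mod m = \<phi> a" "edge_sums m (x' # zs) = map \<phi> v"
      unfolding e by auto
    have "x = x'"
      using L p by (intro eq_if_add_mod_eq[of x y m x']) (auto simp: residue_walks_def)
    then show ?R using L p e' by (auto simp: residue_walks_def intro!: exI[of _ \<phi>])
  next
    assume R: ?R
    then obtain \<phi> where "edge_sums m (xs @ x # zs) = map \<phi> (u @ v)"
      unfolding residue_walks_def by blast
    with l1 have p: "edge_sums m (xs @ [x]) = map \<phi> u" "edge_sums m (x # zs) = map \<phi> v"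
      unfolding e' by auto
    define \<psi> where "\<psi> = \<phi>(a := (x + y) mod m)"
    have "map \<psi> u = map \<phi> u" "map \<psi> v = map \<phi> v" "\<psi> a = (x + y) mod m"
      using a by (auto simp: \<psi>_def)
    then have "edge_sums m (xs @ [x, y, x'] @ zs) = map \<psi> (u @ [a, a] @ v)"
      unfolding e using R p by (simp add: add.commute)
    then show ?L using R unfolding residue_walks_def by auto
  qed
qed

text \<open>Inductions along deletions carry the letter counts instead of
  \<open>pair_matched\<close>, because a deletion can break the alphabetical order: aabb becomes
  bb.\<close>

lemma pairs_delete_double:
  assumes "\<forall>b\<in>set (u @ [a, a] @ v). count_list (u @ [a, a] @ v) b = 2"
  shows "a \<notin> set u" "a \<notin> set v" "\<forall>b\<in>set (u @ v). count_list (u @ v) b = 2"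
proof -
  have "count_list u a + count_list v a = 0" using assms by auto
  then show a: "a \<notin> set u" "a \<notin> set v" by (auto simp: count_list_0_iff)
  show "\<forall>b\<in>set (u @ v). count_list (u @ v) b = 2"
  proof
    fix b assume b: "b \<in> set (u @ v)"
    then have "b \<noteq> a" using a by auto
    moreover have "count_list (u @ [a, a] @ v) b = 2" using b assms by auto
    ultimately show "count_list (u @ v) b = 2" by auto
  qed
qed

lemma split_list_at:
  assumes "length xs = Suc (p + q)"
  obtains ys y zs where "xs = ys @ y # zs" "length ys = p" "length zs = q"
  using id_take_nth_drop[of p xs] assms
  by (metis add_diff_cancel_left' diff_Suc_Suc length_drop length_take less_add_Suc1 min.absorb2
      less_imp_le_nat add_Suc_right add_Suc)

lemma split_list_at3:
  assumes "length xs = Suc (Suc (Suc (p + q)))"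
  obtains ys x y z zs where "xs = ys @ [x, y, z] @ zs" "length ys = p" "length zs = q"
proof -
  obtain ys x zs where 1: "xs = ys @ x # zs" "length ys = p" "length zs = Suc (Suc q)"
    using split_list_at[of xs p "Suc (Suc q)"] assms by auto
  moreover obtain y z zs' where "zs = y # z # zs'" "length zs' = q"
    using 1(3) by (auto simp: length_Suc_conv)
  ultimately show ?thesis using that by simp
qed

text \<open>Replacing \<open>x, y, x\<close> by \<open>x\<close> changes neither end of a walk, and
  for the empty word a walk is a single residue. So the circuit condition holds automatically at the
  level of residues.\<close>

lemma residue_walks_closed:
  assumes "delete_double\<^sup>*\<^sup>* w []" "\<forall>b\<in>set w. count_list w b = 2" "rs \<in> residue_walks m w"
  shows "hd rs = last rs"
  using assms
proof (induction arbitrary: rs rule: converse_rtranclp_induct)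
  case base
  then show ?case by (auto simp: residue_walks_def length_Suc_conv)
next
  case (step w w')
  from step.hyps(1) obtain u a v where w: "w = u @ [a, a] @ v" "w' = u @ v"
    by cases
  note pd = pairs_delete_double[OF step.prems(1)[unfolded w]]
  have "length rs = Suc (Suc (Suc (length u + length v)))"
    using step.prems(2) w by (auto simp: residue_walks_def)
  then obtain xs x y z zs where rs: "rs = xs @ [x, y, z] @ zs" "length xs = length u"
    "length zs = length v"
    by (rule split_list_at3)
  then have "z = x \<and> xs @ x # zs \<in> residue_walks m w'"
    using step.prems(2) residue_walks_insert_double[of xs u zs v a x y z m] pd w by simp
  then show ?case using step.IH[of "xs @ x # zs"] pd(3) w rs by (cases xs) auto
qed

section \<open>Weighted sums over residue walks\<close>

definition walk_weight :: "(nat \<Rightarrow> nat) \<Rightarrow> nat list \<Rightarrow> nat list \<Rightarrow> nat" where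
  "walk_weight c bs rs = prod_list (map2 (\<lambda>b r. c r ^ b) bs rs)"

text \<open>The two vertices with residue \<open>x\<close> merge and their powers of
  \<open>c x\<close> multiply; this is why weights carry a list of exponents.\<close>

lemma walk_weight_delete_double:
  assumes "length xs = length bs"
  shows "walk_weight c (bs @ [b, d, b'] @ bs') (xs @ [x, y, x] @ zs) =
    c y ^ d * walk_weight c (bs @ (b + b') # bs') (xs @ x # zs)"
  using assms by (simp add: walk_weight_def power_add mult_ac)

lemma sum_residue_walks_delete_double:
  assumes a: "a \<notin> set u" "a \<notin> set v"
    and lb: "length bs = length u" "length bs' = length v"
  shows "(\<Sum>rs\<in>residue_walks m (u @ [a, a] @ v). walk_weight c (bs @ [b, d, b'] @ bs') rs) =
    (\<Sum>y<m. c y ^ d) * (\<Sum>rs\<in>residue_walks m (u @ v). walk_weight c (bs @ (b + b') # bs') rs)"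
proof -
  let ?p = "length u"
  have "(\<Sum>y<m. c y ^ d) * (\<Sum>rs\<in>residue_walks m (u @ v). walk_weight c (bs @ (b + b') # bs') rs) =
    (\<Sum>(y, rs)\<in>{..<m} \<times> residue_walks m (u @ v). c y ^ d * walk_weight c (bs @ (b + b') # bs') rs)"
    by (simp add: sum_product sum.cartesian_product)
  also have "\<dots> = (\<Sum>rs\<in>residue_walks m (u @ [a, a] @ v). walk_weight c (bs @ [b, d, b'] @ bs') rs)"
  \<comment> \<open>\<open>j\<close> inserts \<open>y\<close> and a second copy of entry
    \<open>?p\<close> right after that entry; \<open>i\<close> reads off the middle entry and
    removes it together with the copy.\<close>
  proof (rule sum.reindex_bij_witness[where
        j = "\<lambda>(y, rs). take (Suc ?p) rs @ [y, rs ! ?p] @ drop (Suc ?p) rs" and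
        i = "\<lambda>rs. (rs ! Suc ?p, take (Suc ?p) rs @ drop (Suc (Suc (Suc ?p))) rs)"], goal_cases)
    case (1 yr)
    then obtain y rs where yr: "yr = (y, rs)" "y < m" "rs \<in> residue_walks m (u @ v)" by auto
    then have "length rs = Suc (?p + length v)" by (simp add: residue_walks_def)
    then obtain xs x zs where rs: "rs = xs @ x # zs" "length xs = ?p" "length zs = length v"
      by (rule split_list_at)
    then show ?case using yr by (simp add: nth_append)
  next
    case (2 yr)
    then obtain y rs where yr: "yr = (y, rs)" "y < m" "rs \<in> residue_walks m (u @ v)" by auto
    then have "length rs = Suc (?p + length v)" by (simp add: residue_walks_def)
    then obtain xs x zs where rs: "rs = xs @ x # zs" "length xs = ?p" "length zs = length v"
      by (rule split_list_at)
    then show ?case using yr residue_walks_insert_double[of xs u zs v a x y x m] a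
      by (simp add: nth_append)
  next
    case (3 rs)
    then have "length rs = Suc (Suc (Suc (?p + length v)))" by (simp add: residue_walks_def)
    then obtain xs x y z zs where rs: "rs = xs @ [x, y, z] @ zs" "length xs = ?p"
      "length zs = length v"
      by (rule split_list_at3)
    then show ?case
      using 3 residue_walks_insert_double[of xs u zs v a x y z m] a by (simp add: nth_append)
  next
    case (4 rs)
    then have "length rs = Suc (Suc (Suc (?p + length v)))" by (simp add: residue_walks_def)
    then obtain xs x y z zs where rs: "rs = xs @ [x, y, z] @ zs" "length xs = ?p"
      "length zs = length v"
      by (rule split_list_at3)
    then show ?case
      using 4 residue_walks_insert_double[of xs u zs v a x y z m] a by (simp add: nth_append)
  next
    case (5 yr)
    then obtain y rs where yr: "yr = (y, rs)" "y < m" "rs \<in> residue_walks m (u @ v)" by auto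
    then have "length rs = Suc (?p + length v)" by (simp add: residue_walks_def)
    then obtain xs x zs where rs: "rs = xs @ x # zs" "length xs = ?p" "length zs = length v"
      by (rule split_list_at)
    then show ?case
      using yr walk_weight_delete_double[of xs bs c b d b' bs' x y zs] lb
      by (simp add: nth_append)
  qed
  finally show ?thesis by simp
qed

text \<open>Each deletion contributes the exponent of its middle vertex to \<open>ds\<close>, and
  the single vertex left at the end contributes the last one. The list \<open>ds\<close> is chosen
  before \<open>m\<close> and \<open>c\<close>, so that it stays fixed when \<open>n\<close> and
  \<open>\<theta>\<close> vary.\<close>

lemma sum_residue_walks_factorization:
  assumes "delete_double\<^sup>*\<^sup>* w []" "\<forall>b\<in>set w. count_list w b = 2" "length bs = Suc (length w)"
  shows "\<exists>ds. length ds = Suc (length w div 2) \<and> sum_list ds = sum_list bs \<and>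
    (\<forall>m c. (\<Sum>rs\<in>residue_walks m w. walk_weight c bs rs) = prod_list (map (\<lambda>d. \<Sum>r<m. c r ^ d) ds))"
  using assms
proof (induction arbitrary: bs rule: converse_rtranclp_induct)
  case base
  then obtain b where bs: "bs = [b]" by (auto simp: length_Suc_conv)
  have "residue_walks m [] = (\<lambda>r. [r]) ` {..<m}" for m
    by (auto simp: residue_walks_def length_Suc_conv)
  then have "(\<Sum>rs\<in>residue_walks m []. walk_weight c bs rs) = (\<Sum>r<m. c r ^ b)" for m c
    by (simp add: sum.reindex inj_on_def walk_weight_def bs)
  then show ?case by (intro exI[of _ "[b]"]) (simp add: bs)
next
  case (step w w')
  from step.hyps(1) obtain u a v where w: "w = u @ [a, a] @ v" "w' = u @ v"
    by cases
  note pd = pairs_delete_double[OF step.prems(1)[unfolded w]]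
  have "length bs = Suc (Suc (Suc (length u + length v)))" using step.prems(2) w by simp
  then obtain bs1 b d b' bs2 where bs: "bs = bs1 @ [b, d, b'] @ bs2" "length bs1 = length u"
    "length bs2 = length v"
    by (rule split_list_at3)
  obtain ds where ds: "length ds = Suc (length w' div 2)"
    "sum_list ds = sum_list (bs1 @ (b + b') # bs2)"
    "\<And>m c. (\<Sum>rs\<in>residue_walks m w'. walk_weight c (bs1 @ (b + b') # bs2) rs) =
      prod_list (map (\<lambda>d. \<Sum>r<m. c r ^ d) ds)"
    using step.IH[of "bs1 @ (b + b') # bs2"] pd(3) bs w by auto
  show ?case
    using ds sum_residue_walks_delete_double[OF pd(1,2) bs(2,3)]
    by (intro exI[of _ "d # ds"]) (simp add: w(1) bs(1) w(2)[symmetric], simp add: w(2))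
qed

section \<open>Residue classes in \<open>{1..n}\<close> and the number of matched circuits\<close>

definition residue_count :: "nat \<Rightarrow> nat \<Rightarrow> nat \<Rightarrow> nat" where
  "residue_count n m r = card {x \<in> {1..n}. x mod m = r}"

text \<open>The summand \<open>(m - r) div m\<close> is 1 for \<open>r = 0\<close> and 0 otherwise: it stands for the number 0, which
  is missing from \<open>{1..n}\<close>.\<close>

lemma residue_count_add_div:
  assumes "r < m"
  shows "residue_count n m r + (m - r) div m = (n + (m - r)) div m"
proof (induction n)
  case 0
  then show ?case by (simp add: residue_count_def)
next
  case (Suc n)
  \<comment> \<open>On passing to \<open>Suc n\<close>, the quotient on the right jumps exactly when
    \<open>m\<close> divides \<open>Suc n + (m - r)\<close>, and this is when \<open>Suc n\<close>
    is a new member of the class of \<open>r\<close>.\<close>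
  have iff: "(Suc n + (m - r)) mod m = 0 \<longleftrightarrow> Suc n mod m = r"
  proof -
    have "(Suc n + (m - r)) mod m = 0 \<longleftrightarrow> (int (Suc n) - int r) mod int m = 0"
    proof -
      have "int ((Suc n + (m - r)) mod m) = (int (Suc n) - int r + int m) mod int m"
        using assms by (simp add: zmod_int of_nat_diff algebra_simps)
      then show ?thesis by (metis mod_add_self2 of_nat_0 of_nat_eq_iff)
    qed
    also have "\<dots> \<longleftrightarrow> int (Suc n) mod int m = int r mod int m"
      by (simp only: mod_eq_dvd_iff mod_eq_0_iff_dvd)
    also have "\<dots> \<longleftrightarrow> Suc n mod m = r"
      using assms by (metis mod_less of_nat_eq_iff zmod_int)
    finally show ?thesis .
  qed
  have "{x \<in> {1..Suc n}. x mod m = r} =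
      (if Suc n mod m = r then insert (Suc n) {x \<in> {1..n}. x mod m = r} else {x \<in> {1..n}. x mod m = r})"
    by (auto simp: atLeastAtMostSuc_conv)
  then have "residue_count (Suc n) m r = residue_count n m r + (if Suc n mod m = r then 1 else 0)"
    by (simp add: residue_count_def)
  moreover have "(Suc n + (m - r)) div m =
      (n + (m - r)) div m + (if (Suc n + (m - r)) mod m = 0 then 1 else 0)"
    using div_Suc[of "n + (m - r)" m] by simp
  ultimately show ?case using Suc.IH iff by simp
qed

text \<open>For \<open>r > 0\<close> the correction term vanishes and the count is a quotient whose
  numerator lies between \<open>n\<close> and \<open>n + m\<close>.\<close>

lemma residue_count_bounds:
  assumes "r < m"
  shows "residue_count n m r = n div m \<or> residue_count n m r = Suc (n div m)"
proof (cases "r = 0")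
  case True
  then show ?thesis using residue_count_add_div[OF assms, of n] assms by simp
next
  case False
  then have "residue_count n m r = (n + (m - r)) div m"
    using residue_count_add_div[OF assms, of n] assms by simp
  moreover have "n div m \<le> (n + (m - r)) div m" by (intro div_le_mono) simp
  moreover have "(n + (m - r)) div m \<le> (n + m) div m" by (intro div_le_mono) simp
  ultimately show ?thesis using assms by auto
qed

lemma sum_residue_count:
  assumes "m > 0"
  shows "(\<Sum>r<m. residue_count n m r) = n"
proof -
  have "(\<Sum>r<m. residue_count n m r) = card (\<Union>r<m. {x \<in> {1..n}. x mod m = r})"
    unfolding residue_count_def by (subst card_UN_disjoint) auto
  also have "(\<Union>r<m. {x \<in> {1..n}. x mod m = r}) = {1..n}" using assms by auto
  finally show ?thesis by simp
qed

text \<open>At the only two possible counts \<open>q\<close> and \<open>q + 1\<close>, the power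
  agrees with the chord through these points. The chord is affine, so its sum depends only on the
  sum of the counts, which is \<open>n\<close>.\<close>

lemma sum_residue_count_power:
  fixes n m d :: nat
  assumes "m > 0"
  defines "q \<equiv> real (n div m)"
  shows "real (\<Sum>r<m. residue_count n m r ^ d) =
    real m * q ^ d + (real n - real m * q) * ((q + 1) ^ d - q ^ d)"
proof -
  have "real (residue_count n m r ^ d) =
      q ^ d + (real (residue_count n m r) - q) * ((q + 1) ^ d - q ^ d)" if "r < m" for r
    using residue_count_bounds[OF that, of n]
  proof
    assume "residue_count n m r = n div m"
    then show ?thesis by (simp add: q_def)
  next
    assume "residue_count n m r = Suc (n div m)"
    then have "real (residue_count n m r) = q + 1" by (simp add: q_def)
    then show ?thesis by simp
  qed
  then have "real (\<Sum>r<m. residue_count n m r ^ d) =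
      (\<Sum>r<m. q ^ d + (real (residue_count n m r) - q) * ((q + 1) ^ d - q ^ d))"
    by simp
  also have "\<dots> = real m * q ^ d + (real (\<Sum>r<m. residue_count n m r) - real m * q) * ((q + 1) ^ d - q ^ d)"
    by (simp add: sum.distrib sum_subtractf sum_distrib_right[symmetric])
  finally show ?thesis using sum_residue_count[OF assms(1)] by simp
qed

text \<open>The last vertex has exponent 0, because the value there is the one at the first vertex.\<close>

lemma card_matched_circuits:
  fixes \<theta> :: real and n :: nat and w :: "nat list"
  defines "m \<equiv> nat \<lfloor>real n / \<theta>\<rfloor>"
  assumes m: "m > 0" and w: "w \<noteq> []"
    and closed: "\<And>rs. rs \<in> residue_walks m w \<Longrightarrow> hd rs = last rs"
  shows "card (matched_circuits \<theta> n w) =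
    (\<Sum>rs\<in>residue_walks m w. walk_weight (residue_count n m) (replicate (length w) 1 @ [0]) rs)"
proof -
  let ?l = "length w"
  define res where "res \<pi> = map (\<lambda>i. \<pi> i mod m) [0..<Suc ?l]" for \<pi> :: "nat \<Rightarrow> nat"
  have es: "edge_sums m (res \<pi>) = map (\<lambda>i. link \<theta> n (\<pi> i) (\<pi> (Suc i))) [0..<?l]" for \<pi>
    by (rule nth_equalityI)
      (auto simp: res_def nth_edge_sums link_def m_def[symmetric] mod_add_eq simp del: upt_Suc)
  have walk_iff: "res \<pi> \<in> residue_walks m w \<longleftrightarrow>
      (\<forall>i\<in>{1..?l}. \<forall>j\<in>{1..?l}. w ! (i - 1) = w ! (j - 1) \<longrightarrow>
          link \<theta> n (\<pi> (i - 1)) (\<pi> i) = link \<theta> n (\<pi> (j - 1)) (\<pi> j))" (is "_ \<longleftrightarrow> ?M \<pi>") for \<pi>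
  proof -
    let ?e = "\<lambda>i. link \<theta> n (\<pi> i) (\<pi> (Suc i))"
    have "res \<pi> \<in> residue_walks m w \<longleftrightarrow> (\<exists>\<phi>. map ?e [0..<?l] = map \<phi> w)"
    proof -
      have "set (res \<pi>) \<subseteq> {..<m}" "length (res \<pi>) = Suc ?l"
        using m by (auto simp: res_def simp del: upt_Suc)
      then show ?thesis by (simp add: residue_walks_def es del: map_eq_conv)
    qed
    also have "\<dots> \<longleftrightarrow> (\<exists>\<phi>. \<forall>i<?l. ?e i = \<phi> (w ! i))"
    proof -
      have "map ?e [0..<?l] = map \<phi> w \<longleftrightarrow> (\<forall>i<?l. ?e i = \<phi> (w ! i))" for \<phi>
        by (subst list_eq_iff_nth_eq) simp
      then show ?thesis by (simp only:)
    qed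
    also have "\<dots> \<longleftrightarrow> (\<forall>i<?l. \<forall>j<?l. w ! i = w ! j \<longrightarrow> ?e i = ?e j)"
    proof
      assume *: "\<forall>i<?l. \<forall>j<?l. w ! i = w ! j \<longrightarrow> ?e i = ?e j"
      \<comment> \<open>The value of \<open>\<phi>\<close> at a letter is read off at one chosen
        occurrence of it.\<close>
      define occ where "occ x = (SOME j. j < ?l \<and> w ! j = x)" for x
      have "?e i = ?e (occ (w ! i))" if "i < ?l" for i
      proof -
        have "occ (w ! i) < ?l \<and> w ! occ (w ! i) = w ! i"
          unfolding occ_def by (rule someI[of _ i]) (simp add: that)
        then show ?thesis using *[rule_format, OF that, of "occ (w ! i)"] by metis
      qed
      then show "\<exists>\<phi>. \<forall>i<?l. ?e i = \<phi> (w ! i)"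
        by (intro exI[of _ "\<lambda>x. ?e (occ x)"] allI impI)
    next
      assume "\<exists>\<phi>. \<forall>i<?l. ?e i = \<phi> (w ! i)"
      then obtain \<phi> where "\<forall>i<?l. ?e i = \<phi> (w ! i)" ..
      then show "\<forall>i<?l. \<forall>j<?l. w ! i = w ! j \<longrightarrow> ?e i = ?e j" by simp
    qed
    also have "\<dots> \<longleftrightarrow> ?M \<pi>"
      \<comment> \<open>Positions counted from 1 are shifted to list indices counted from 0.\<close>
      unfolding image_Suc_lessThan[symmetric] by (simp, simp add: Ball_def)
    finally show ?thesis .
  qed
  have mc: "matched_circuits \<theta> n w = {\<pi> \<in> circuits ?l n. res \<pi> \<in> residue_walks m w}"
    unfolding matched_circuits_def walk_iff ..
  have fin: "finite (circuits ?l n)"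
    unfolding circuits_def by (rule finite_subset[of _ "{0..?l} \<rightarrow>\<^sub>E {1..n}"]) (auto intro: finite_PiE)
  have fibre: "card {\<pi> \<in> circuits ?l n. res \<pi> = rs} =
      walk_weight (residue_count n m) (replicate ?l 1 @ [0]) rs" if rs: "rs \<in> residue_walks m w" for rs
  proof -
    have lrs: "length rs = Suc ?l" using rs by (simp add: residue_walks_def)
    \<comment> \<open>Needed so that the value copied from vertex 0 to the last vertex has the
      prescribed residue there.\<close>
    have cl: "rs ! 0 = rs ! ?l" using closed[OF rs] lrs
      by (metis hd_conv_nth last_conv_nth diff_Suc_1 length_0_conv nat.distinct(1))
    let ?P = "\<Pi>\<^sub>E i\<in>{..<?l}. {x \<in> {1..n}. x mod m = rs ! i}"
    have res_iff: "res \<pi> = rs \<longleftrightarrow> (\<forall>i\<le>?l. \<pi> i mod m = rs ! i)" for \<pi>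
      using lrs by (auto simp: res_def list_eq_iff_nth_eq less_Suc_eq_le simp del: upt_Suc)
    \<comment> \<open>A circuit in the fibre amounts to independent choices at all vertices but the
      last, each from its residue class; the inverse map copies the value at 0 to the end.\<close>
    have bij: "bij_betw (\<lambda>\<pi>. restrict \<pi> {..<?l}) {\<pi> \<in> circuits ?l n. res \<pi> = rs} ?P"
    proof (rule bij_betw_byWitness[where f' = "\<lambda>f. restrict (f(?l := f 0)) {0..?l}"], goal_cases)
      case 1
      show ?case
      proof
        fix \<pi> assume "\<pi> \<in> {\<pi> \<in> circuits ?l n. res \<pi> = rs}"
        then have "\<pi> \<in> extensional {0..?l}" "\<pi> 0 = \<pi> ?l" by (auto simp: circuits_def PiE_def)
        then show "restrict ((restrict \<pi> {..<?l})(?l := restrict \<pi> {..<?l} 0)) {0..?l} = \<pi>"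
          using w by (intro ext) (auto simp: restrict_def extensional_def)
      qed
    next
      case 2
      show ?case
      proof
        fix f assume "f \<in> ?P"
        then have "f \<in> extensional {..<?l}" by (simp add: PiE_def)
        then show "restrict (restrict (f(?l := f 0)) {0..?l}) {..<?l} = f"
          by (intro ext) (auto simp: restrict_def extensional_def)
      qed
    next
      case 3
      show ?case
        by (auto simp: circuits_def res_iff PiE_iff split: if_splits)
    next
      case 4
      show ?case
      proof (rule image_subsetI)
        fix f assume f: "f \<in> ?P"
        then have f': "f i \<in> {1..n} \<and> f i mod m = rs ! i" if "i < ?l" for i
          using that by (auto simp: PiE_iff)
        have "(f(?l := f 0)) i \<in> {1..n} \<and> (f(?l := f 0)) i mod m = rs ! i" if "i \<le> ?l" for i
          using f'[of i] f'[of 0] w cl that by (cases "i = ?l") auto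
        then show "restrict (f(?l := f 0)) {0..?l} \<in> {\<pi> \<in> circuits ?l n. res \<pi> = rs}"
          using w by (auto simp: circuits_def res_iff)
      qed
    qed
    have "rs = butlast rs @ [last rs]" using lrs by (metis append_butlast_last_id length_0_conv nat.distinct(1))
    then have "walk_weight (residue_count n m) (replicate ?l 1 @ [0]) rs =
        walk_weight (residue_count n m) (replicate ?l 1 @ [0]) (butlast rs @ [last rs])"
      by simp
    also have "\<dots> = prod_list (map (residue_count n m) (butlast rs))"
      using lrs by (simp add: walk_weight_def zip_replicate1 comp_def)
    also have "\<dots> = (\<Prod>i<?l. residue_count n m (rs ! i))"
      using lrs by (simp add: prod.list_conv_set_nth nth_butlast atLeast0LessThan)
    also have "\<dots> = card ?P"
      by (simp add: card_PiE residue_count_def)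
    finally show ?thesis using bij_betw_same_card[OF bij] by simp
  qed
  have "card (matched_circuits \<theta> n w) = card (\<Union>rs\<in>residue_walks m w. {\<pi> \<in> circuits ?l n. res \<pi> = rs})"
    unfolding mc by (rule arg_cong[of _ _ card]) auto
  also have "\<dots> = (\<Sum>rs\<in>residue_walks m w. card {\<pi> \<in> circuits ?l n. res \<pi> = rs})"
    using fin by (subst card_UN_disjoint) (auto simp: finite_residue_walks)
  finally show ?thesis using fibre by simp
qed

section \<open>Limits in \<open>n\<close>, then in \<open>\<theta>\<close>\<close>

lemma tendsto_prod_list:
  fixes f :: "'b \<Rightarrow> 'a \<Rightarrow> real"
  assumes "\<And>d. d \<in> set ds \<Longrightarrow> (f d \<longlongrightarrow> g d) F"
  shows "((\<lambda>x. prod_list (map (\<lambda>d. f d x) ds)) \<longlongrightarrow> prod_list (map g ds)) F"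
  using assms by (induction ds) (auto intro!: tendsto_mult)

text \<open>The limit of \<open>(\<Sum>\<^sub>r c(r)\<^sup>d) / n\<close>: the proportion of residues with \<open>c(r) = \<lfloor>\<theta>\<rfloor> + 1\<close> is the
  fractional part of \<open>\<theta>\<close>.\<close>

definition residue_moment :: "nat \<Rightarrow> real \<Rightarrow> real" where
  "residue_moment d \<theta> = (let q = real_of_int \<lfloor>\<theta>\<rfloor> in
     (q ^ d + (\<theta> - q) * ((q + 1) ^ d - q ^ d)) / \<theta>)"

lemma floor_ratio_tendsto:
  fixes \<theta> :: real
  assumes "\<theta> > 0"
  shows "(\<lambda>n. real (nat \<lfloor>real n / \<theta>\<rfloor>) / real n) \<longlonglongrightarrow> 1 / \<theta>"
proof (rule tendsto_sandwich)
  show "\<forall>\<^sub>F n in sequentially. 1 / \<theta> - 1 / real n \<le> real (nat \<lfloor>real n / \<theta>\<rfloor>) / real n"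
    using eventually_gt_at_top[of 0]
  proof eventually_elim
    case (elim n)
    have "real n / \<theta> - 1 \<le> real (nat \<lfloor>real n / \<theta>\<rfloor>)" using assms by linarith
    then have "(real n / \<theta> - 1) / real n \<le> real (nat \<lfloor>real n / \<theta>\<rfloor>) / real n"
      by (rule divide_right_mono) simp
    then show ?case using elim by (simp add: diff_divide_distrib)
  qed
  show "\<forall>\<^sub>F n in sequentially. real (nat \<lfloor>real n / \<theta>\<rfloor>) / real n \<le> 1 / \<theta>"
    using eventually_gt_at_top[of 0]
  proof eventually_elim
    case (elim n)
    have "real (nat \<lfloor>real n / \<theta>\<rfloor>) \<le> real n / \<theta>" using assms by simp
    then have "real (nat \<lfloor>real n / \<theta>\<rfloor>) / real n \<le> (real n / \<theta>) / real n"
      by (rule divide_right_mono) simp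
    then show ?case using elim by simp
  qed
  show "(\<lambda>n. 1 / \<theta> - 1 / real n) \<longlonglongrightarrow> 1 / \<theta>"
    using tendsto_diff[OF tendsto_const lim_1_over_n, of "1 / \<theta>"] by simp
qed simp

lemma eventually_floor_pos:
  fixes \<theta> :: real
  assumes "\<theta> > 0"
  shows "\<forall>\<^sub>F n in sequentially. nat \<lfloor>real n / \<theta>\<rfloor> > 0"
proof -
  obtain N where N: "\<theta> \<le> real N" using real_arch_simple by blast
  show ?thesis using eventually_ge_at_top[of N]
  proof eventually_elim
    case (elim n)
    then have "real n / \<theta> \<ge> 1" using N assms by simp
    then show ?case by (simp add: le_floor_iff)
  qed
qed

text \<open>Write \<open>m\<close> for the modulus. Then \<open>n / m\<close> tends to
  \<open>\<theta>\<close> and is never below it, so it ends up in the interval from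
  \<open>\<theta>\<close> to the next larger integer. Integer values of \<open>\<theta>\<close>
  cause no jump of the floor, as they are approached from above.\<close>

lemma eventually_div_eq_floor:
  fixes \<theta> :: real
  assumes "\<theta> > 0"
  shows "\<forall>\<^sub>F n in sequentially. real (n div nat \<lfloor>real n / \<theta>\<rfloor>) = of_int \<lfloor>\<theta>\<rfloor>"
proof -
  have "1 / (of_int \<lfloor>\<theta>\<rfloor> + 1) < 1 / \<theta>"
    using assms by (intro divide_strict_left_mono) (auto intro!: mult_pos_pos, linarith)
  then have "\<forall>\<^sub>F n in sequentially. 1 / (of_int \<lfloor>\<theta>\<rfloor> + 1) < real (nat \<lfloor>real n / \<theta>\<rfloor>) / real n"
    using floor_ratio_tendsto[OF assms] order_tendstoD(1) by blast
  then show ?thesis using eventually_floor_pos[OF assms] eventually_gt_at_top[of 0]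
  proof eventually_elim
    case (elim n)
    define m where "m = nat \<lfloor>real n / \<theta>\<rfloor>"
    have m: "m > 0" using elim m_def by simp
    have "real m \<le> real n / \<theta>" using assms by (simp add: m_def)
    then have "\<theta> \<le> real n / real m" using assms m by (simp add: field_simps)
    moreover have "real n / real m < of_int \<lfloor>\<theta>\<rfloor> + 1"
    proof -
      have "0 < (of_int \<lfloor>\<theta>\<rfloor> + 1 :: real)" using assms by linarith
      then show ?thesis using elim(1,3) m unfolding m_def[symmetric] by (simp add: field_simps)
    qed
    ultimately have "\<lfloor>real n / real m\<rfloor> = \<lfloor>\<theta>\<rfloor>" by linarith
    moreover have "\<lfloor>real n / real m\<rfloor> = int (n div m)" by (rule floor_divide_of_nat_eq)
    ultimately show ?case unfolding m_def[symmetric] by simp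
  qed
qed

lemma residue_moment_limit:
  fixes \<theta> :: real
  assumes "\<theta> > 0"
  shows "(\<lambda>n. real (\<Sum>r<nat \<lfloor>real n / \<theta>\<rfloor>. residue_count n (nat \<lfloor>real n / \<theta>\<rfloor>) r ^ d) / real n)
    \<longlonglongrightarrow> residue_moment d \<theta>"
proof -
  define q where "q = real_of_int \<lfloor>\<theta>\<rfloor>"
  let ?m = "\<lambda>n. nat \<lfloor>real n / \<theta>\<rfloor>"
  \<comment> \<open>For fixed \<open>q\<close>, the formula of
    \<open>sum_residue_count_power\<close> divided by \<open>n\<close> is affine in
    \<open>?m n / n\<close>.\<close>
  have "(\<lambda>n. real (?m n) / real n * q ^ d + (1 - real (?m n) / real n * q) * ((q + 1) ^ d - q ^ d))
    \<longlonglongrightarrow> 1 / \<theta> * q ^ d + (1 - 1 / \<theta> * q) * ((q + 1) ^ d - q ^ d)"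
    by (intro tendsto_intros floor_ratio_tendsto assms)
  also have "1 / \<theta> * q ^ d + (1 - 1 / \<theta> * q) * ((q + 1) ^ d - q ^ d) = residue_moment d \<theta>"
    using assms by (simp add: residue_moment_def q_def[symmetric] field_simps)
  finally show ?thesis
  proof (rule Lim_transform_eventually)
    show "\<forall>\<^sub>F n in sequentially.
        real (?m n) / real n * q ^ d + (1 - real (?m n) / real n * q) * ((q + 1) ^ d - q ^ d) =
        real (\<Sum>r<?m n. residue_count n (?m n) r ^ d) / real n"
      using eventually_floor_pos[OF assms] eventually_div_eq_floor[OF assms] eventually_gt_at_top[of 0]
    proof eventually_elim
      case (elim n)
      then show ?case unfolding sum_residue_count_power[OF elim(1)] elim(2) q_def[symmetric]
        by (simp add: add_divide_distrib diff_divide_distrib left_diff_distrib)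
    qed
  qed
qed

text \<open>The numerator of the moment interpolates between \<open>q ^ d\<close> and
  \<open>(q + 1) ^ d\<close> with weight \<open>\<theta> - q\<close> in the unit interval, and both
  bounds are asymptotic to \<open>\<theta> ^ d\<close>. Writing
  \<open>\<theta> / \<theta> ^ d\<close> keeps the case \<open>d = 0\<close> correct, where
  \<open>d - 1\<close> would be truncated.\<close>

lemma residue_moment_asymp:
  "((\<lambda>\<theta>. residue_moment d \<theta> * \<theta> / \<theta> ^ d) \<longlongrightarrow> 1) at_top"
proof -
  have inv: "((\<lambda>\<theta>::real. 1 / \<theta>) \<longlongrightarrow> 0) at_top"
    by (intro tendsto_divide_0[OF tendsto_const] filterlim_at_top_imp_at_infinity filterlim_ident)
  have fl: "((\<lambda>\<theta>::real. of_int \<lfloor>\<theta>\<rfloor> / \<theta>) \<longlongrightarrow> 1) at_top"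
  proof (rule tendsto_sandwich)
    show "((\<lambda>\<theta>::real. 1 - 1 / \<theta>) \<longlongrightarrow> 1) at_top"
      using tendsto_diff[OF tendsto_const inv, of 1] by simp
    show "\<forall>\<^sub>F \<theta>::real in at_top. 1 - 1 / \<theta> \<le> of_int \<lfloor>\<theta>\<rfloor> / \<theta>"
      using eventually_gt_at_top[of 0]
    proof eventually_elim
      case (elim \<theta>)
      have "(\<theta> - 1) / \<theta> \<le> of_int \<lfloor>\<theta>\<rfloor> / \<theta>"
        using elim by (intro divide_right_mono) linarith+
      then show ?case using elim by (simp add: diff_divide_distrib)
    qed
    show "\<forall>\<^sub>F \<theta>::real in at_top. of_int \<lfloor>\<theta>\<rfloor> / \<theta> \<le> 1"
      using eventually_gt_at_top[of 0] by eventually_elim simp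
  qed simp
  show ?thesis
  proof (rule tendsto_sandwich)
    show "((\<lambda>\<theta>::real. (of_int \<lfloor>\<theta>\<rfloor> / \<theta>) ^ d) \<longlongrightarrow> 1) at_top"
      using tendsto_power[OF fl, of d] by simp
    show "((\<lambda>\<theta>::real. (of_int \<lfloor>\<theta>\<rfloor> / \<theta> + 1 / \<theta>) ^ d) \<longlongrightarrow> 1) at_top"
      using tendsto_power[OF tendsto_add[OF fl inv], of d] by simp
    have *: "q ^ d \<le> q ^ d + (\<theta> - q) * ((q + 1) ^ d - q ^ d) \<and>
        q ^ d + (\<theta> - q) * ((q + 1) ^ d - q ^ d) \<le> (q + 1) ^ d"
      if "\<theta> \<ge> 1" "q = of_int \<lfloor>\<theta>\<rfloor>" for \<theta> q :: real
    proof -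
      have q: "0 \<le> q" "0 \<le> \<theta> - q" "\<theta> - q \<le> 1" using that by linarith+
      then have "q ^ d \<le> (q + 1) ^ d" by (intro power_mono) auto
      then show ?thesis
        using q mult_right_mono[OF q(3), of "(q + 1) ^ d - q ^ d"]
          mult_nonneg_nonneg[OF q(2), of "(q + 1) ^ d - q ^ d"] by simp
    qed
    show "\<forall>\<^sub>F \<theta> in at_top. (of_int \<lfloor>\<theta>\<rfloor> / \<theta>) ^ d \<le> residue_moment d \<theta> * \<theta> / \<theta> ^ d"
      using eventually_ge_at_top[of 1]
      by eventually_elim (use *[OF _ refl] in \<open>simp add: residue_moment_def Let_def power_divide divide_right_mono\<close>)
    show "\<forall>\<^sub>F \<theta> in at_top. residue_moment d \<theta> * \<theta> / \<theta> ^ d \<le> (of_int \<lfloor>\<theta>\<rfloor> / \<theta> + 1 / \<theta>) ^ d"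
      using eventually_ge_at_top[of 1]
      by eventually_elim (use *[OF _ refl] in \<open>simp add: residue_moment_def Let_def power_divide divide_right_mono
            add_divide_distrib[symmetric]\<close>)
  qed
qed

lemma prod_list_divide_power:
  fixes f :: "'b \<Rightarrow> real"
  shows "prod_list (map f ds) / c ^ length ds = prod_list (map (\<lambda>d. f d / c) ds)"
  by (induction ds) (auto simp flip: times_divide_times_eq)

theorem corollary4p3:
  fixes k :: nat and w :: "nat list"
  assumes "k \<ge> 1" and "w \<in> catalan_words k"
  shows "((\<lambda>\<theta>::real. word_limit \<theta> w / \<theta> ^ (k - 1)) \<longlongrightarrow> 1) at_top"
proof -
  have len: "length w = 2 * k" and cnt: "\<forall>b\<in>set w. count_list w b = 2"
    and red: "delete_double\<^sup>*\<^sup>* w []"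
    using assms(2) by (auto simp: catalan_words_def pair_matched_def)
  have wne: "w \<noteq> []" using len assms(1) by auto
  \<comment> \<open>The initial exponents are \<open>2 * k\<close> ones and a zero.\<close>
  obtain ds where ds: "length ds = Suc k" "sum_list ds = 2 * k"
    "\<And>m c. (\<Sum>rs\<in>residue_walks m w. walk_weight c (replicate (length w) 1 @ [0]) rs) =
      prod_list (map (\<lambda>d. \<Sum>r<m. c r ^ d) ds)"
    using sum_residue_walks_factorization[OF red cnt, of "replicate (length w) 1 @ [0]"] len
    by (auto simp: sum_list_replicate)
  \<comment> \<open>As \<open>word_limit\<close> is a \<open>lim\<close>, proving convergence
    determines its value. The \<open>k + 1\<close> powers of \<open>n\<close> go one to each power
    sum.\<close>
  have lim: "word_limit \<theta> w = prod_list (map (\<lambda>d. residue_moment d \<theta>) ds)" if "\<theta> > 0" for \<theta>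
  proof -
    let ?m = "\<lambda>n. nat \<lfloor>real n / \<theta>\<rfloor>"
    have "(\<lambda>n. prod_list (map (\<lambda>d. real (\<Sum>r<?m n. residue_count n (?m n) r ^ d) / real n) ds))
      \<longlonglongrightarrow> prod_list (map (\<lambda>d. residue_moment d \<theta>) ds)"
      by (intro tendsto_prod_list residue_moment_limit that)
    moreover have "\<forall>\<^sub>F n in sequentially.
        prod_list (map (\<lambda>d. real (\<Sum>r<?m n. residue_count n (?m n) r ^ d) / real n) ds) =
        real (card (matched_circuits \<theta> n w)) / real n ^ (length w div 2 + 1)"
      using eventually_floor_pos[OF that]
    proof eventually_elim
      case (elim n)
      have "card (matched_circuits \<theta> n w) =
          prod_list (map (\<lambda>d. \<Sum>r<?m n. residue_count n (?m n) r ^ d) ds)"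
        using card_matched_circuits[OF elim wne residue_walks_closed[OF red cnt]] ds(3) by simp
      moreover have "real (prod_list xs) = prod_list (map real xs)" for xs
        by (induction xs) auto
      ultimately have "real (card (matched_circuits \<theta> n w)) =
          prod_list (map (\<lambda>d. real (\<Sum>r<?m n. residue_count n (?m n) r ^ d)) ds)"
        by (simp add: comp_def)
      then show ?case using ds(1) len
        by (simp add: prod_list_divide_power[symmetric] del: power_Suc)
    qed
    ultimately show ?thesis
      unfolding word_limit_def by (intro limI) (rule Lim_transform_eventually)
  qed
  \<comment> \<open>Each factor supplies one \<open>\<theta>\<close> to the numerator, while the
    exponents add up in the denominator.\<close>
  have scale: "prod_list (map (\<lambda>d. f d * \<theta> / \<theta> ^ d) ds') =
      prod_list (map f ds') * \<theta> ^ length ds' / \<theta> ^ sum_list ds'" for f :: "nat \<Rightarrow> real" and \<theta> ds'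
    by (induction ds') (auto simp: power_add)
  have "((\<lambda>\<theta>. prod_list (map (\<lambda>d. residue_moment d \<theta> * \<theta> / \<theta> ^ d) ds)) \<longlongrightarrow>
      prod_list (map (\<lambda>d. 1) ds)) at_top"
    by (intro tendsto_prod_list residue_moment_asymp)
  moreover have "prod_list (map (\<lambda>d. 1 :: real) ds) = 1" by (induction ds) auto
  moreover have "\<forall>\<^sub>F \<theta> in at_top. prod_list (map (\<lambda>d. residue_moment d \<theta> * \<theta> / \<theta> ^ d) ds) =
      word_limit \<theta> w / \<theta> ^ (k - 1)"
    using eventually_gt_at_top[of 0]
  proof eventually_elim
    case (elim \<theta>)
    \<comment> \<open>After cancelling \<open>\<theta> ^ Suc k\<close> the denominator is
      \<open>\<theta> ^ (k - 1)\<close>; the subtraction is exact as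
      \<open>k \<ge> 1\<close>.\<close>
    have "2 * k = Suc k + (k - 1)" using assms(1) by simp
    then have "\<theta> ^ (2 * k) = \<theta> ^ Suc k * \<theta> ^ (k - 1)" by (metis power_add)
    then show ?case using elim by (simp add: scale ds lim del: power_Suc)
  qed
  ultimately show ?thesis using Lim_transform_eventually by fastforce
qed

end
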